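(* Let $A\in\mathbb{R}^{m\times n}$ with $m\le n$ and let $S_1=(I,s)$ be a Recoverable Support of $A$. (1) Let $w\in\mathbb{R}^m$ satisfy $A_I^Tw=s$ and $\|A_{I^c}^Tw\|_\infty<1$. If there is $y\in\ker(A_I^T)$ satisfying $\|A_{I^c}^T(w+y)\|_\infty=1$ and such that, with $J=\{i : |a_i^T(w+y)|=1\}$, the submatrix $A_J$ has full rank, then with $t=A_J^T(w+y)$ the pair $S_2=(J,t)$ is a Recoverable Support of $A$ and $I\subset J$. (2) Let $|I|>1$. For any $j_0\in I$ there exists $\tilde s\in\{-1,1\}^{I\setminus\{j_0\}}$ with $\tilde s_i=s_i$ for all $i\in I\setminus\{j_0\}$ such that the pair $S_3=(I\setminus\{j_0\},\tilde s)$ is a Recoverable Support of $A$.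
   Context: For $A\in\mathbb{R}^{m\times n}$, $a_i$ denotes the $i$-th column of $A$; for $I\subset\{1,\dots,n\}$, $A_I$ denotes the submatrix of $A$ formed by the columns indexed by $I$, $A_I^T$ its transpose, and $I^c=\{1,\dots,n\}\setminus I$. Such a submatrix "has full rank" means that it is injective, i.e. its columns are linearly independent. A sup-norm over an empty index set is $0$. A pair $(I,s)$ with $I\subset\{1,\dots,n\}$, $|I|\le m$, and $s\in\{-1,1\}^I$ is a Recoverable Support of $A$ (of size $|I|$) if $A_I$ has full rank and there exists $w\in\mathbb{R}^m$ with $A_I^Tw=s$ and $\|A_{I^c}^Tw\|_\infty<1$. *)

theory Defs
  imports "HOL-Analysis.Analysis" "HOL-Library.FuncSet"
begin

text \<open>
  For an index set \<open>I\<close>, vectors in \<open>\<real>\<^sup>I\<close> are extensional functions, that is, elements of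
  \<open>I \<rightarrow>\<^sub>E UNIV\<close>, and sign vectors are elements of \<open>I \<rightarrow>\<^sub>E {-1, 1}\<close>.  The column submatrix
  \<open>A\<^sub>I\<close> is represented by its action \<open>\<real>\<^sup>I \<rightarrow> \<real>\<^sup>m\<close>, its transpose by its action \<open>\<real>\<^sup>m \<rightarrow> \<real>\<^sup>I\<close>.
\<close>

definition submat_mult :: "real^'n^'m \<Rightarrow> 'n::finite set \<Rightarrow> ('n \<Rightarrow> real) \<Rightarrow> real^'m::finite" where
  "submat_mult A I x = (\<Sum>i\<in>I. x i *\<^sub>R column i A)"

definition submat_transpose_mult ::
    "real^'n^'m \<Rightarrow> 'n::finite set \<Rightarrow> real^'m::finite \<Rightarrow> 'n \<Rightarrow> real" where
  "submat_transpose_mult A I w = (\<lambda>i\<in>I. column i A \<bullet> w)"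

definition submat_transpose_ker ::
    "real^'n^'m \<Rightarrow> 'n::finite set \<Rightarrow> (real^'m::finite) set" where
  "submat_transpose_ker A I = {y. submat_transpose_mult A I y = (\<lambda>i\<in>I. 0)}"

definition submat_full_rank :: "real^'n^'m::finite \<Rightarrow> 'n::finite set \<Rightarrow> bool" where
  "submat_full_rank A I \<longleftrightarrow> inj_on (submat_mult A I) (I \<rightarrow>\<^sub>E UNIV)"

text \<open>Inserting \<open>0\<close> makes the norm over the empty index set \<open>0\<close> and is harmless otherwise.\<close>

definition sup_norm_on :: "'n::finite set \<Rightarrow> ('n \<Rightarrow> real) \<Rightarrow> real" where
  "sup_norm_on K v = Max (insert 0 ((\<lambda>i. \<bar>v i\<bar>) ` K))"

definition recoverable_support ::
    "real^'n^'m::finite \<Rightarrow> 'n::finite set \<times> ('n \<Rightarrow> real) \<Rightarrow> bool" where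
  "recoverable_support A = (\<lambda>(I, s).
     card I \<le> CARD('m) \<and>
     s \<in> I \<rightarrow>\<^sub>E {-1, 1} \<and>
     submat_full_rank A I \<and>
     (\<exists>w. submat_transpose_mult A I w = s \<and>
          sup_norm_on (- I) (submat_transpose_mult A (- I) w) < 1))"

lemma submat_mult_UNIV: "submat_mult A UNIV x = A *v (\<chi> i. x i)"
  by (simp add: submat_mult_def matrix_mult_sum scalar_mult_eq_scaleR)

lemma submat_transpose_mult_UNIV: "submat_transpose_mult A UNIV w = (\<lambda>i. (transpose A *v w) $ i)"
  by (simp add: submat_transpose_mult_def matrix_vector_mult_def column_def transpose_def
      inner_vec_def fun_eq_iff)

lemma submat_full_rank_iff_independent:
  "submat_full_rank A I \<longleftrightarrow>
     inj_on (\<lambda>i. column i A) I \<and> independent ((\<lambda>i. column i A) ` I)"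
proof -
  have "submat_full_rank A I \<longleftrightarrow>
      (\<forall>x. submat_mult A I x = 0 \<longrightarrow> (\<forall>i\<in>I. x i = 0))" (is "_ \<longleftrightarrow> ?K")
  proof
    assume inj: "submat_full_rank A I"
    show ?K
    proof (intro allI impI ballI)
      fix x i assume x: "submat_mult A I x = 0" and i: "i \<in> I"
      have "submat_mult A I (restrict x I) = submat_mult A I (\<lambda>i\<in>I. 0)"
        using x by (simp add: submat_mult_def)
      then have "restrict x I = (\<lambda>i\<in>I. 0)"
        by (rule inj_onD[OF inj[unfolded submat_full_rank_def]]) auto
      then show "x i = 0" using i by (auto dest: fun_cong[of _ _ i])
    qed
  next
    assume K: ?K
    show "submat_full_rank A I"
      unfolding submat_full_rank_def
    proof (rule inj_onI)
      fix x y assume xy: "x \<in> I \<rightarrow>\<^sub>E UNIV" "y \<in> I \<rightarrow>\<^sub>E UNIV"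
        and eq: "submat_mult A I x = submat_mult A I y"
      have "submat_mult A I (\<lambda>i. x i - y i) = 0"
        using eq by (simp add: submat_mult_def scaleR_left_diff_distrib sum_subtractf)
      then have "\<forall>i\<in>I. x i - y i = 0" using K by blast
      then have "\<And>i. i \<in> I \<Longrightarrow> x i = y i" by simp
      then show "x = y" using xy by (rule PiE_ext[rotated 2])
    qed
  qed
  also have "?K \<longleftrightarrow> inj_on (\<lambda>i. column i A) I \<and> independent ((\<lambda>i. column i A) ` I)"
  proof
    assume K: ?K
    have inj: "inj_on (\<lambda>i. column i A) I"
    proof (rule inj_onI, rule ccontr)
      fix i j assume ij: "i \<in> I" "j \<in> I" "column i A = column j A" "i \<noteq> j"
      let ?x = "\<lambda>k. if k = i then 1 else if k = j then - 1 else (0::real)"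
      have "submat_mult A I ?x = (\<Sum>k\<in>{i, j}. ?x k *\<^sub>R column k A)"
        unfolding submat_mult_def using ij by (intro sum.mono_neutral_right) auto
      also have "\<dots> = 0" using ij by simp
      finally have "?x i = 0" using K ij(1) by blast
      then show False by simp
    qed
    moreover have "independent ((\<lambda>i. column i A) ` I)"
    proof (rule independent_if_scalars_zero)
      fix f v
      assume f: "(\<Sum>v\<in>(\<lambda>i. column i A) ` I. f v *\<^sub>R v) = 0"
        and v: "v \<in> (\<lambda>i. column i A) ` I"
      have "submat_mult A I (\<lambda>i. f (column i A)) = 0"
        using f by (simp add: submat_mult_def sum.reindex[OF inj])
      then have "\<forall>i\<in>I. f (column i A) = 0" using K by blast
      then show "f v = 0" using v by blast
    qed simp
    ultimately show "inj_on (\<lambda>i. column i A) I \<and> independent ((\<lambda>i. column i A) ` I)" by simp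
  next
    assume *: "inj_on (\<lambda>i. column i A) I \<and> independent ((\<lambda>i. column i A) ` I)"
    show ?K
    proof (intro allI impI ballI)
      fix x i assume x: "submat_mult A I x = 0" and i: "i \<in> I"
      let ?g = "\<lambda>v. x (the_inv_into I (\<lambda>i. column i A) v)"
      have g: "?g (column k A) = x k" if "k \<in> I" for k
        using the_inv_into_f_f[of "\<lambda>i. column i A" I k] * that by simp
      have "(\<Sum>v\<in>(\<lambda>i. column i A) ` I. ?g v *\<^sub>R v) = submat_mult A I x"
        unfolding submat_mult_def using * g by (simp add: sum.reindex)
      then have "(\<Sum>v\<in>(\<lambda>i. column i A) ` I. ?g v *\<^sub>R v) = 0"
        using x by simp
      then have "?g (column i A) = 0"
        using * i independentD[of "(\<lambda>i. column i A) ` I" "(\<lambda>i. column i A) ` I" ?g "column i A"]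
        by simp
      then show "x i = 0" using g[OF i] by simp
    qed
  qed
  finally show ?thesis .
qed

end

theory Submission
  imports Defs
begin

text \<open>
  In part (1) the vector \<open>w + y\<close> itself certifies \<open>(J, t)\<close>.  In part (2), decompose
  \<open>a\<^sub>j\<^sub>0 = u + z\<close> with \<open>u\<close> in the span of the other columns of \<open>A\<^sub>I\<close> and \<open>z\<close> orthogonal to it.
  By injectivity of \<open>A\<^sub>I\<close>, \<open>z \<noteq> 0\<close>, so moving a certificate \<open>w\<close> slightly along
  \<open>- s\<^sub>j\<^sub>0 z\<close> keeps the signs on \<open>I - {j\<^sub>0}\<close> and the strict inequalities off \<open>I\<close>, and makes
  the entry at \<open>j\<^sub>0\<close> strictly smaller than \<open>1\<close> in modulus.
\<close>

text \<open>The conjunct \<open>0 < c\<close> comes from the inserted \<open>0\<close> and decides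
  the case of empty \<open>K\<close>.\<close>

lemma sup_norm_on_less_iff:
  "sup_norm_on K v < c \<longleftrightarrow> 0 < c \<and> (\<forall>i\<in>K. \<bar>v i\<bar> < c)"
  unfolding sup_norm_on_def by (subst Max_less_iff) auto

lemma sup_norm_on_le_iff:
  "sup_norm_on K v \<le> c \<longleftrightarrow> 0 \<le> c \<and> (\<forall>i\<in>K. \<bar>v i\<bar> \<le> c)"
  unfolding sup_norm_on_def by (subst Max_le_iff) auto

lemma submat_full_rank_card_le:
  fixes A :: "real^'n^'m"
  assumes "submat_full_rank A I"
  shows "card I \<le> CARD('m)"
proof -
  have "inj_on (\<lambda>i. column i A) I" "independent ((\<lambda>i. column i A) ` I)"
    using assms by (auto simp: submat_full_rank_iff_independent)
  then show ?thesis
    using independent_bound[of "(\<lambda>i. column i A) ` I"] by (simp add: card_image)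
qed

lemma submat_full_rank_mono:
  assumes "submat_full_rank A J" and "I \<subseteq> J"
  shows "submat_full_rank A I"
  using assms unfolding submat_full_rank_iff_independent
  by (meson image_mono independent_mono inj_on_subset)

text \<open>Common last step of both parts: the sign vector is read off from the certificate
  \<open>w\<close>, so only moduli of its entries have to be checked. The size bound follows from
  independence of the columns in a space of dimension \<open>CARD('m)\<close>.\<close>

lemma recoverable_supportI:
  assumes "submat_full_rank A I"
    and "\<And>i. i \<in> I \<Longrightarrow> \<bar>column i A \<bullet> w\<bar> = 1"
    and "\<And>i. i \<notin> I \<Longrightarrow> \<bar>column i A \<bullet> w\<bar> < 1"
  shows "recoverable_support A (I, submat_transpose_mult A I w)"
proof -
  have "submat_transpose_mult A I w \<in> I \<rightarrow>\<^sub>E {-1, 1}"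
    using assms(2) by (auto simp: submat_transpose_mult_def abs_eq_iff')
  moreover have "sup_norm_on (- I) (submat_transpose_mult A (- I) w) < 1"
    using assms(3) by (simp add: sup_norm_on_less_iff submat_transpose_mult_def)
  ultimately show ?thesis
    using assms(1) submat_full_rank_card_le by (auto simp: recoverable_support_def)
qed

lemma recoverable_support_extend:
  assumes s: "s \<in> I \<rightarrow>\<^sub>E {-1, 1}" and w: "submat_transpose_mult A I w = s"
    and y: "y \<in> submat_transpose_ker A I"
    and norm: "sup_norm_on (- I) (submat_transpose_mult A (- I) (w + y)) \<le> 1"
    and J: "J = {i. \<bar>column i A \<bullet> (w + y)\<bar> = 1}" and rank: "submat_full_rank A J"
  shows "recoverable_support A (J, submat_transpose_mult A J (w + y))" and "I \<subseteq> J"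
proof -
  have ker: "column i A \<bullet> y = 0" if "i \<in> I" for i
    using y that
    by (auto simp: submat_transpose_ker_def submat_transpose_mult_def dest: fun_cong[of _ _ i])
  have "\<bar>column i A \<bullet> w\<bar> = 1" if "i \<in> I" for i
    using s that by (auto simp: w[symmetric] submat_transpose_mult_def dest: funcset_mem)
  then show sub: "I \<subseteq> J" by (auto simp: J inner_add_right ker)
  \<comment> \<open>Off \<open>J\<close> the modulus is at most \<open>1\<close> by the norm bound
    and differs from \<open>1\<close> by the choice of \<open>J\<close>.\<close>
  have "\<bar>column i A \<bullet> (w + y)\<bar> < 1" if "i \<notin> J" for i
  proof -
    have "i \<notin> I" using sub that by blast
    then have "\<bar>column i A \<bullet> (w + y)\<bar> \<le> 1"
      using norm by (simp add: sup_norm_on_le_iff submat_transpose_mult_def)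
    then show ?thesis using that J by (simp add: less_le)
  qed
  then show "recoverable_support A (J, submat_transpose_mult A J (w + y))"
    using rank J by (intro recoverable_supportI) auto
qed

text \<open>Such a \<open>z\<close> is a direction along which the entry at \<open>j\<close> varies
  while the other entries on \<open>I\<close> stay fixed.\<close>

lemma submat_full_rank_dual_vector:
  assumes "submat_full_rank A I" and "j \<in> I"
  obtains z where "\<And>i. i \<in> I - {j} \<Longrightarrow> column i A \<bullet> z = 0" and "column j A \<bullet> z = 1"
proof -
  let ?a = "\<lambda>i. column i A"
  have inj: "inj_on ?a I" and "independent (?a ` I)"
    using assms(1) by (auto simp: submat_full_rank_iff_independent)
  \<comment> \<open>Injectivity ensures that no other index in \<open>I\<close> carries the same
    column as \<open>j\<close>.\<close>
  moreover have "?a ` I - {?a j} = ?a ` (I - {j})"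
    using inj assms(2) by (auto dest: inj_onD)
  ultimately have notin: "?a j \<notin> span (?a ` (I - {j}))"
    using assms(2) by (metis dependent_def imageI)
  obtain u z where u: "u \<in> span (?a ` (I - {j}))" and a: "?a j = u + z"
    and orth: "\<And>v. v \<in> span (?a ` (I - {j})) \<Longrightarrow> orthogonal z v"
    using orthogonal_subspace_decomp_exists[of "?a ` (I - {j})" "?a j"] by metis
  have "z \<noteq> 0" using notin u a by auto
  moreover have "?a j \<bullet> z = z \<bullet> z"
    using orth[OF u] by (simp add: a inner_add_left inner_commute[of u] orthogonal_def)
  moreover have "?a i \<bullet> z = 0" if "i \<in> I - {j}" for i
    using orth[of "?a i"] that by (simp add: span_base inner_commute orthogonal_def)
  \<comment> \<open>Since \<open>z \<bullet> z\<close> is nonzero, dividing by it normalises the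
    product with column \<open>j\<close> to \<open>1\<close>.\<close>
  ultimately show ?thesis
    by (intro that[of "(1 / (z \<bullet> z)) *\<^sub>R z"]) auto
qed

lemma recoverable_support_delete:
  assumes rs: "recoverable_support A (I, s)" and j: "j \<in> I"
  shows "recoverable_support A (I - {j}, restrict s (I - {j}))"
proof -
  obtain w where s: "s \<in> I \<rightarrow>\<^sub>E {-1, 1}" and rank: "submat_full_rank A I"
    and w: "submat_transpose_mult A I w = s"
    and norm: "sup_norm_on (- I) (submat_transpose_mult A (- I) w) < 1"
    using rs by (auto simp: recoverable_support_def)
  have on: "column i A \<bullet> w = s i" if "i \<in> I" for i
    using that by (simp add: w[symmetric] submat_transpose_mult_def)
  have off: "\<bar>column i A \<bullet> w\<bar> < 1" if "i \<notin> I" for i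
    using norm that by (simp add: sup_norm_on_less_iff submat_transpose_mult_def)
  obtain z where z0: "\<And>i. i \<in> I - {j} \<Longrightarrow> column i A \<bullet> z = 0" and z1: "column j A \<bullet> z = 1"
    using submat_full_rank_dual_vector[OF rank j] by blast
  \<comment> \<open>The factor \<open>s j\<close> directs the move so that the entry at
    \<open>j\<close> becomes \<open>(1 - \<epsilon>) * s j\<close>, which shrinks in modulus for
    either sign.\<close>
  define w' where "w' \<epsilon> = w - (\<epsilon> * s j) *\<^sub>R z" for \<epsilon> :: real
  have "\<forall>\<^sub>F \<epsilon> in at_right 0. \<bar>column i A \<bullet> w' \<epsilon>\<bar> < 1" if "i \<notin> I" for i
  proof -
    \<comment> \<open>Continuity in \<open>\<epsilon>\<close>: the limit is the entry of
      \<open>w\<close> itself, which lies strictly below \<open>1\<close> in modulus.\<close>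
    have "((\<lambda>\<epsilon>. \<bar>column i A \<bullet> w' \<epsilon>\<bar>) \<longlongrightarrow> \<bar>column i A \<bullet> (w - (0 * s j) *\<^sub>R z)\<bar>) (at_right 0)"
      unfolding w'_def by (intro tendsto_intros)
    then show ?thesis
      using off[OF that] by (intro order_tendstoD(2)) auto
  qed
  \<comment> \<open>As \<open>- I\<close> is finite, one small \<open>\<epsilon>\<close> serves all
    its indices at once.\<close>
  then have "\<forall>\<^sub>F \<epsilon> in at_right 0. \<forall>i\<in>- I. \<bar>column i A \<bullet> w' \<epsilon>\<bar> < 1"
    by (intro eventually_ball_finite) auto
  moreover have "\<forall>\<^sub>F \<epsilon> in at_right (0::real). 0 < \<epsilon> \<and> \<epsilon> < 1"
    using eventually_at_right_real[of 0 1] by simp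
  ultimately have "\<forall>\<^sub>F \<epsilon> in at_right 0.
      (\<forall>i\<in>- I. \<bar>column i A \<bullet> w' \<epsilon>\<bar> < 1) \<and> 0 < \<epsilon> \<and> \<epsilon> < 1"
    by (rule eventually_conj)
  then obtain \<epsilon> where \<epsilon>: "\<forall>i\<in>- I. \<bar>column i A \<bullet> w' \<epsilon>\<bar> < 1" "0 < \<epsilon>" "\<epsilon> < 1"
    using eventually_happens'[OF trivial_limit_at_right_real] by blast
  have abs_s: "\<bar>s i\<bar> = 1" if "i \<in> I" for i
    using s that by (auto dest: PiE_mem)
  have on': "column i A \<bullet> w' \<epsilon> = s i" if "i \<in> I - {j}" for i
    using that by (simp add: w'_def inner_diff_right on z0)
  have "column j A \<bullet> w' \<epsilon> = (1 - \<epsilon>) * s j"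
    using j by (simp add: w'_def inner_diff_right on z1 algebra_simps)
  then have "\<bar>column j A \<bullet> w' \<epsilon>\<bar> < 1"
    using \<epsilon> abs_s[OF j] by (simp add: abs_mult)
  \<comment> \<open>The complement has gained exactly the index \<open>j\<close>, whose entry was
    just bounded.\<close>
  then have "\<bar>column i A \<bullet> w' \<epsilon>\<bar> < 1" if "i \<notin> I - {j}" for i
    using that \<epsilon>(1) by (cases "i = j") auto
  moreover have "submat_full_rank A (I - {j})"
    using rank by (rule submat_full_rank_mono) auto
  ultimately have "recoverable_support A (I - {j}, submat_transpose_mult A (I - {j}) (w' \<epsilon>))"
    using on' abs_s by (intro recoverable_supportI) auto
  moreover have "submat_transpose_mult A (I - {j}) (w' \<epsilon>) = restrict s (I - {j})"
    unfolding submat_transpose_mult_def using on' by (intro restrict_ext) auto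
  ultimately show ?thesis by simp
qed

theorem theorem2:
  fixes A :: "real^'n^'m" and I :: "'n set" and s :: "'n \<Rightarrow> real"
  assumes "CARD('m) \<le> CARD('n)"
    and "recoverable_support A (I, s)"
  shows
    "(\<forall>w. submat_transpose_mult A I w = s \<longrightarrow>
          sup_norm_on (- I) (submat_transpose_mult A (- I) w) < 1 \<longrightarrow>
        (\<forall>y \<in> submat_transpose_ker A I.
          sup_norm_on (- I) (submat_transpose_mult A (- I) (w + y)) = 1 \<longrightarrow>
          (let J = {i. \<bar>column i A \<bullet> (w + y)\<bar> = 1};
               t = submat_transpose_mult A J (w + y)
           in submat_full_rank A J \<longrightarrow> recoverable_support A (J, t) \<and> I \<subseteq> J)))
     \<and> (card I > 1 \<longrightarrow>
        (\<forall>j\<^sub>0 \<in> I. \<exists>s' \<in> (I - {j\<^sub>0}) \<rightarrow>\<^sub>E {-1, 1}.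
          (\<forall>i \<in> I - {j\<^sub>0}. s' i = s i) \<and>
          recoverable_support A (I - {j\<^sub>0}, s')))"
proof (intro conjI impI allI ballI)
  have s: "s \<in> I \<rightarrow>\<^sub>E {-1, 1}"
    using assms(2) by (simp add: recoverable_support_def)
  fix w y
  assume "submat_transpose_mult A I w = s" and "y \<in> submat_transpose_ker A I"
    and "sup_norm_on (- I) (submat_transpose_mult A (- I) (w + y)) = 1"
  then show "let J = {i. \<bar>column i A \<bullet> (w + y)\<bar> = 1};
      t = submat_transpose_mult A J (w + y)
      in submat_full_rank A J \<longrightarrow> recoverable_support A (J, t) \<and> I \<subseteq> J"
    \<comment> \<open>Here \<open>refl\<close> fixes \<open>J\<close> as the set of indices of
      modulus \<open>1\<close>, and \<open>order_refl\<close> weakens the norm equality to the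
      required bound.\<close>
    using recoverable_support_extend[OF s _ _ _ refl] unfolding Let_def
    by (metis order_refl)
next
  fix j\<^sub>0 assume "j\<^sub>0 \<in> I"
  with assms(2) have rs: "recoverable_support A (I - {j\<^sub>0}, restrict s (I - {j\<^sub>0}))"
    by (rule recoverable_support_delete)
  \<comment> \<open>Sign vectors are extensional, so \<open>s\<close> has to be restricted to be one
    on the smaller index set.\<close>
  moreover have "restrict s (I - {j\<^sub>0}) \<in> (I - {j\<^sub>0}) \<rightarrow>\<^sub>E {-1, 1}"
    using rs by (simp add: recoverable_support_def)
  ultimately show "\<exists>s' \<in> (I - {j\<^sub>0}) \<rightarrow>\<^sub>E {-1, 1}.
      (\<forall>i \<in> I - {j\<^sub>0}. s' i = s i) \<and> recoverable_support A (I - {j\<^sub>0}, s')"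
    by (intro bexI[of _ "restrict s (I - {j\<^sub>0})"]) auto
qed

end
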